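(* Let $\eta=(\eta_1,\dots,\eta_t)$ be a sequence of positive integers with sum $n$, let $\gamma\in\mathbb{Z}^n$, and let $\lambda\in\mathbb{Z}^n$ be a dominant weight ($\lambda_1\ge\dots\ge\lambda_n$). Then $$K_{\lambda,\gamma,\eta}(q)=\sum_{w\in S_n}(-1)^w\sum_{m}q^{\sum_{(i,j)\in\mathrm{Roots}_\eta}m(i,j)},$$ where the inner sum runs over the functions $m:\mathrm{Roots}_\eta\to\mathbb{N}=\{0,1,2,\dots\}$ satisfying $$\sum_{(i,j)\in\mathrm{Roots}_\eta}m(i,j)(\epsilon_i-\epsilon_j)=w^{-1}(\lambda+\rho)-(\gamma+\rho),$$ $\epsilon_i$ being the $i$-th standard basis vector of $\mathbb{Z}^n$.
   Context: Let $\mathrm{Roots}_\eta=\{(i,j):1\le i\le\eta_1+\dots+\eta_r<j\le n\text{ for some }r\}$, $\rho=(n-1,\dots,1,0)$. $S_n$ acts on $\mathbb{Z}^n$ by $(w^{-1}\alpha)_i=\alpha_{w(i)}$ and on Laurent polynomials in $x_1,\dots,x_n$ by $w\,x^\alpha=x^{w\alpha}$; $(-1)^w$ is the sign of $w$. Put $J(f)=\sum_{w\in S_n}(-1)^w\,wf$, $\pi(f)=J(x^\rho)^{-1}J(x^\rho f)$, and $s_\lambda(x)=\pi(x^\lambda)$ for a dominant weight $\lambda$. Let $B_\eta(x;q)=\prod_{(i,j)\in\mathrm{Roots}_\eta}(1-q\,x_i/x_j)^{-1}$ and $H_{\eta,\gamma}(x;q)=\pi(x^\gamma B_\eta(x;q))$,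 viewed as formal power series in $q$ with coefficients Laurent polynomials in the $x_i$. Then $K_{\lambda,\gamma,\eta}(q)$ is defined by $H_{\eta,\gamma}(x;q)=\sum_\lambda K_{\lambda,\gamma,\eta}(q)s_\lambda(x)$, where $\lambda$ runs over the dominant weights in $\mathbb{Z}^n$. *)

theory Defs
  imports
    "HOL-Library.Poly_Mapping"
    "HOL-Combinatorics.Permutations"
    "HOL-Computational_Algebra.Formal_Power_Series"
begin

text \<open>
  The lattice \<open>\<int>\<^sup>n\<close> is the set of \<open>\<alpha> :: nat \<Rightarrow>\<^sub>0 int\<close> whose support is contained in
  \<open>{1..n}\<close>, and a Laurent polynomial in \<open>x\<^sub>1, \<dots>, x\<^sub>n\<close> with integer coefficients is a
  finitely supported function on weights, with the convolution product. The monomial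
  \<open>x\<^sup>\<alpha>\<close> is \<open>frag_of \<alpha>\<close>.
\<close>

type_synonym weight = "nat \<Rightarrow>\<^sub>0 int"
type_synonym laurent = "weight \<Rightarrow>\<^sub>0 int"

definition weights :: "nat \<Rightarrow> weight set"
  where "weights n = {\<alpha>. Poly_Mapping.keys \<alpha> \<subseteq> {1..n}}"

definition dominant_weights :: "nat \<Rightarrow> weight set"
  where "dominant_weights n =
    {\<alpha> \<in> weights n. \<forall>i j. 1 \<le> i \<and> i \<le> j \<and> j \<le> n \<longrightarrow>
       Poly_Mapping.lookup \<alpha> j \<le> Poly_Mapping.lookup \<alpha> i}"

abbreviation eps :: "nat \<Rightarrow> weight"
  where "eps i \<equiv> frag_of i"

abbreviation xpow :: "weight \<Rightarrow> laurent"
  where "xpow \<alpha> \<equiv> frag_of \<alpha>"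

definition rho :: "nat \<Rightarrow> weight"
  where "rho n = (\<Sum>i=1..n. frag_cmul (int n - int i) (eps i))"

text \<open>\<open>map_key\<close> precomposes with its first argument, so
  \<open>(w \<alpha>)\<^sub>i = \<alpha>\<^bsub>w\<^sup>-\<^sup>1(i)\<^esub>\<close>.\<close>

definition perm_weight :: "(nat \<Rightarrow> nat) \<Rightarrow> weight \<Rightarrow> weight"
  where "perm_weight w \<alpha> = Poly_Mapping.map_key (inv w) \<alpha>"

lemma lookup_perm_weight_inv:
  assumes "w permutes {1..n}"
  shows "Poly_Mapping.lookup (perm_weight (inv w) \<alpha>) i = Poly_Mapping.lookup \<alpha> (w i)"
proof -
  have "bij w" using assms by (rule permutes_bij)
  then have "inv (inv w) = w" and "inj w" by (simp_all add: inv_inv_eq bij_is_inj)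
  then show ?thesis by (simp add: perm_weight_def map_key.rep_eq)
qed

text \<open>Linear extension of \<open>x\<^sup>\<alpha> \<mapsto> x\<^bsup>w\<alpha>\<^esup>\<close>.\<close>

definition perm_laurent :: "(nat \<Rightarrow> nat) \<Rightarrow> laurent \<Rightarrow> laurent"
  where "perm_laurent w = frag_extend (\<lambda>\<alpha>. xpow (perm_weight w \<alpha>))"

definition J :: "nat \<Rightarrow> laurent \<Rightarrow> laurent"
  where "J n f = (\<Sum>w | w permutes {1..n}. frag_cmul (sign w) (perm_laurent w f))"

text \<open>The division \<open>J(x\<^sup>\<rho>)\<^sup>-\<^sup>1 J(x\<^sup>\<rho> f)\<close> is the exact one in the integral domain of
  Laurent polynomials.\<close>

definition Pi_op :: "nat \<Rightarrow> laurent \<Rightarrow> laurent"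
  where "Pi_op n f = (THE g. J n (xpow (rho n)) * g = J n (xpow (rho n) * f))"

definition schur :: "nat \<Rightarrow> weight \<Rightarrow> laurent"
  where "schur n \<mu> = Pi_op n (xpow \<mu>)"

definition Roots :: "nat list \<Rightarrow> (nat \<times> nat) set"
  where "Roots \<eta> = {(i, j). \<exists>r\<in>{1..length \<eta>}.
    1 \<le> i \<and> i \<le> sum_list (take r \<eta>) \<and> sum_list (take r \<eta>) < j \<and> j \<le> sum_list \<eta>}"

text \<open>Power series in \<open>q\<close> are written with \<open>q = fps_X\<close>. The Laurent polynomials have no
  \<open>inverse\<close> operation, so inversion of a power series \<open>F\<close> over them is
  \<open>fps_right_inverse F c\<close>, where \<open>c\<close> is the inverse of the constant term of \<open>F\<close>,
  here \<open>1\<close>.\<close>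

definition root_factor :: "nat \<times> nat \<Rightarrow> laurent fps"
  where "root_factor = (\<lambda>(i, j). 1 - fps_X * fps_const (xpow (eps i - eps j)))"

definition B :: "nat list \<Rightarrow> laurent fps"
  where "B \<eta> = (\<Prod>p\<in>Roots \<eta>. fps_right_inverse (root_factor p) 1)"

lemma root_factor_inverse: "root_factor p * fps_right_inverse (root_factor p) 1 = 1"
  by (rule fps_right_inverse) (simp add: root_factor_def split: prod.split)

text \<open>\<open>\<pi>\<close> is applied to each coefficient of a power series in \<open>q\<close>.\<close>

definition H :: "nat list \<Rightarrow> weight \<Rightarrow> laurent fps"
  where "H \<eta> \<gamma> =
    Abs_fps (\<lambda>d. Pi_op (sum_list \<eta>) (fps_nth (fps_const (xpow \<gamma>) * B \<eta>) d))"

text \<open>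
  The identity \<open>F = (\<Sum>\<mu>. K \<mu> * s\<^sub>\<mu>)\<close> of power series in \<open>q\<close>, with \<open>\<mu>\<close> running over
  the dominant weights. The sum is infinite in general; it is formed coefficientwise in
  \<open>q\<close>, each power of \<open>q\<close> receiving only finitely many nonzero contributions.
\<close>

definition schur_expansion :: "nat \<Rightarrow> laurent fps \<Rightarrow> (weight \<Rightarrow> int fps) \<Rightarrow> bool"
  where "schur_expansion n F K \<longleftrightarrow>
    (\<forall>d. finite {\<mu> \<in> dominant_weights n. fps_nth (K \<mu>) d \<noteq> 0} \<and>
         fps_nth F d =
           (\<Sum>\<mu> | \<mu> \<in> dominant_weights n \<and> fps_nth (K \<mu>) d \<noteq> 0.
              frag_cmul (fps_nth (K \<mu>) d) (schur n \<mu>)))"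

text \<open>The family \<open>K\<close> is indexed by the dominant weights only; it is made a unique total
  function by the value \<open>0\<close> elsewhere.\<close>

definition Kpoly :: "weight \<Rightarrow> weight \<Rightarrow> nat list \<Rightarrow> int fps"
  where "Kpoly \<mu> \<gamma> \<eta> =
    (THE K. schur_expansion (sum_list \<eta>) (H \<eta> \<gamma>) K \<and>
            (\<forall>\<nu>. \<nu> \<notin> dominant_weights (sum_list \<eta>) \<longrightarrow> K \<nu> = 0)) \<mu>"

end

theory Submission
  imports Defs
begin

text \<open>
  Multiplying the defining expansion of \<open>H\<close> by \<open>J(x\<^sup>\<rho>)\<close> turns it into an expansion of
  alternating Laurent polynomials in the \<open>J(x\<^bsup>\<mu>+\<rho>\<^esup>)\<close>, \<open>\<mu>\<close> dominant. There the coefficient of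
  \<open>J(x\<^bsup>\<mu>+\<rho>\<^esup>)\<close> is simply the coefficient of the monomial \<open>x\<^bsup>\<mu>+\<rho>\<^esup>\<close>, since the only strictly
  decreasing weight in the orbit of \<open>\<mu> + \<rho>\<close> is \<open>\<mu> + \<rho>\<close> itself. Reading that coefficient off
  \<open>J(x\<^bsup>\<gamma>+\<rho>\<^esup> B)\<close>, with \<open>B\<close> expanded as a product of geometric series, gives the formula.

  That the division by \<open>J(x\<^sup>\<rho>)\<close> is exact follows from the Vandermonde product: every alternating
  Laurent polynomial is divisible by each \<open>x\<^sub>i - x\<^sub>j\<close>, hence by their product, and this
  product is an integer multiple of \<open>J(x\<^sup>\<rho>)\<close>.
\<close>

subsection \<open>Weights and Laurent polynomials\<close>

abbreviation (input) lookup :: "('a \<Rightarrow>\<^sub>0 'b::zero) \<Rightarrow> 'a \<Rightarrow> 'b"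
  where "lookup \<equiv> Poly_Mapping.lookup"

abbreviation (input) keys :: "('a \<Rightarrow>\<^sub>0 'b::zero) \<Rightarrow> 'a set"
  where "keys \<equiv> Poly_Mapping.keys"

lemma lookup_perm_weight:
  assumes "w permutes {1..n}"
  shows "lookup (perm_weight w \<alpha>) i = lookup \<alpha> (inv w i)"
  using lookup_perm_weight_inv[OF permutes_inv[OF assms]] permutes_inv_inv[OF assms] by simp

lemma perm_weight_compose:
  assumes "u permutes {1..n}" "v permutes {1..n}"
  shows "perm_weight u (perm_weight v \<alpha>) = perm_weight (u \<circ> v) \<alpha>"
proof (rule poly_mapping_eqI)
  fix i
  have "bij u" "bij v" using assms permutes_bij by auto
  then have "inv (u \<circ> v) = inv v \<circ> inv u" by (rule o_inv_distrib)
  then show "lookup (perm_weight u (perm_weight v \<alpha>)) i = lookup (perm_weight (u \<circ> v) \<alpha>) i"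
    by (simp add: lookup_perm_weight[OF assms(1)] lookup_perm_weight[OF assms(2)]
        lookup_perm_weight[OF permutes_compose[OF assms(2,1)]])
qed

lemma perm_weight_id [simp]: "perm_weight id \<alpha> = \<alpha>"
  by (rule poly_mapping_eqI) (simp add: lookup_perm_weight[OF permutes_id])

lemma perm_weight_inverse:
  assumes "w permutes {1..n}"
  shows "perm_weight w (perm_weight (inv w) \<alpha>) = \<alpha>"
    and "perm_weight (inv w) (perm_weight w \<alpha>) = \<alpha>"
  using permutes_inv_o[OF assms]
  by (simp_all add: perm_weight_compose[OF assms permutes_inv[OF assms]]
      perm_weight_compose[OF permutes_inv[OF assms] assms])

lemma perm_weight_add:
  assumes "w permutes {1..n}"
  shows "perm_weight w (\<alpha> + \<beta>) = perm_weight w \<alpha> + perm_weight w \<beta>"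
  by (rule poly_mapping_eqI) (simp add: lookup_perm_weight[OF assms] lookup_add)

lemma weights_iff: "\<alpha> \<in> weights n \<longleftrightarrow> (\<forall>i. i \<notin> {1..n} \<longrightarrow> lookup \<alpha> i = 0)"
  by (auto simp: weights_def in_keys_iff subset_iff)

lemma weights_add: "\<alpha> \<in> weights n \<Longrightarrow> \<beta> \<in> weights n \<Longrightarrow> \<alpha> + \<beta> \<in> weights n"
  by (simp add: weights_iff lookup_add)

lemma weights_diff: "\<alpha> \<in> weights n \<Longrightarrow> \<beta> \<in> weights n \<Longrightarrow> \<alpha> - \<beta> \<in> weights n"
  by (simp add: weights_iff lookup_minus)

lemma perm_weight_in_weights:
  assumes "w permutes {1..n}" "\<alpha> \<in> weights n"
  shows "perm_weight w \<alpha> \<in> weights n"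
  using assms(2) permutes_in_image[OF permutes_inv[OF assms(1)]]
  by (auto simp: weights_iff lookup_perm_weight[OF assms(1)])

lemma lookup_rho: "lookup (rho n) i = (if i \<in> {1..n} then int n - int i else 0)"
proof -
  have "lookup (rho n) i = (\<Sum>k=1..n. if i = k then int n - int k else 0)"
    by (simp add: rho_def lookup_sum if_distrib cong: if_cong)
  then show ?thesis by (simp add: sum.delta)
qed

lemma rho_in_weights: "rho n \<in> weights n"
  by (simp add: weights_iff lookup_rho)

lemma dominant_in_weights: "\<mu> \<in> dominant_weights n \<Longrightarrow> \<mu> \<in> weights n"
  by (simp add: dominant_weights_def)

lemma dominant_add_rho_less:
  assumes "\<mu> \<in> dominant_weights n" "1 \<le> i" "i < j" "j \<le> n"
  shows "lookup (\<mu> + rho n) j < lookup (\<mu> + rho n) i"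
proof -
  have "lookup \<mu> j \<le> lookup \<mu> i" using assms by (auto simp: dominant_weights_def)
  then show ?thesis using assms by (simp add: lookup_add lookup_rho)
qed

lemma lookup_perm_laurent:
  assumes "w permutes {1..n}"
  shows "lookup (perm_laurent w f) \<alpha> = lookup f (perm_weight (inv w) \<alpha>)"
proof -
  have "\<alpha> = perm_weight w \<beta> \<longleftrightarrow> perm_weight (inv w) \<alpha> = \<beta>" for \<beta>
    using perm_weight_inverse[OF assms] by metis
  note * = this
  show ?thesis
    using subset_UNIV
    by (induction f rule: frag_induction)
      (auto simp: perm_laurent_def frag_extend_diff lookup_minus *)
qed

text \<open>Both sides are additive in each factor, so only monomials have to be compared. An
  arbitrary additive \<open>h\<close> is allowed because the lemma serves both the permutation
  action and the substitution \<open>merge\<close> below.\<close>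

lemma frag_extend_single_mult:
  fixes h :: "'a::monoid_add \<Rightarrow> 'b::monoid_add"
  assumes "\<And>a b. h (a + b) = h a + h b"
  shows "frag_extend (\<lambda>a. frag_of (h a)) (f * g) =
    frag_extend (\<lambda>a. frag_of (h a)) f * frag_extend (\<lambda>a. frag_of (h a)) g"
proof -
  let ?E = "frag_extend (\<lambda>a. frag_of (h a))"
  have single: "?E (frag_of a * g) = ?E (frag_of a) * ?E g" for a
    using subset_UNIV
    by (induction g rule: frag_induction)
      (auto simp: frag_extend_diff right_diff_distrib mult_single assms)
  show ?thesis
    using subset_UNIV
    by (induction f rule: frag_induction)
      (auto simp: frag_extend_diff left_diff_distrib single simp del: frag_extend_of)
qed

lemma frag_extend_single_prod:
  fixes h :: "'a::comm_monoid_add \<Rightarrow> 'b::comm_monoid_add"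
  assumes "\<And>a b. h (a + b) = h a + h b" "h 0 = 0"
  shows "frag_extend (\<lambda>a. frag_of (h a)) (\<Prod>i\<in>I. f i) =
    (\<Prod>i\<in>I. frag_extend (\<lambda>a. frag_of (h a)) (f i))"
proof (induction I rule: infinite_finite_induct)
  case (insert i I)
  then show ?case by (simp add: frag_extend_single_mult assms)
qed (simp_all add: assms flip: single_one)

text \<open>Integer scaling becomes multiplication by a constant of the ring, so scaled terms can be
  rearranged and tested for divisibility by ring laws.\<close>

lemma frag_cmul_eq_mult: "frag_cmul c f = of_int c * (f :: 'a::monoid_add \<Rightarrow>\<^sub>0 int)"
proof -
  have *: "frag_cmul (int k) f = of_int (int k) * f" for k
    by (induction k) (simp_all add: frag_cmul_distrib distrib_right)
  have "frag_cmul (- int k) f = of_int (- int k) * f" for k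
    using *[of k] by (simp flip: minus_frag_cmul)
  with * show ?thesis by (cases c rule: int_cases2) auto
qed

subsection \<open>Alternating Laurent polynomials\<close>

text \<open>Antisymmetry is imposed on coefficients, the form in which they are compared along an
  orbit. The support condition keeps exponents in \<open>weights n\<close>, where sorting by a
  permutation of \<open>{1..n}\<close> is possible.\<close>

definition alternating :: "nat \<Rightarrow> laurent \<Rightarrow> bool"
  where "alternating n f \<longleftrightarrow> keys f \<subseteq> weights n \<and>
    (\<forall>w \<alpha>. w permutes {1..n} \<longrightarrow> lookup f (perm_weight w \<alpha>) = sign w * lookup f \<alpha>)"

lemma alternating_perm_laurent:
  assumes "alternating n f" "w permutes {1..n}"
  shows "perm_laurent w f = frag_cmul (sign w) f"
proof (rule poly_mapping_eqI)
  fix \<alpha>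
  have "sign (inv w) = sign w"
    using assms(2) permutation_permutes sign_inverse by blast
  then show "lookup (perm_laurent w f) \<alpha> = lookup (frag_cmul (sign w) f) \<alpha>"
    using assms permutes_inv[OF assms(2)]
    by (simp add: lookup_perm_laurent[OF assms(2)] alternating_def)
qed

lemma alternating_diff:
  "alternating n f \<Longrightarrow> alternating n g \<Longrightarrow> alternating n (f - g)"
  using keys_diff[of f g] by (auto simp: alternating_def lookup_minus right_diff_distrib)

lemma alternating_cmul: "alternating n f \<Longrightarrow> alternating n (frag_cmul c f)"
  using keys_cmul[of c f] by (auto simp: alternating_def)

lemma alternating_sum:
  "(\<And>i. i \<in> I \<Longrightarrow> alternating n (f i)) \<Longrightarrow> alternating n (\<Sum>i\<in>I. f i)"
  using keys_sum[of f I] by (fastforce simp: alternating_def lookup_sum sum_distrib_left)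

section \<open>The antisymmetrizer \<open>J\<close> and its coefficients on orbits\<close>

lemma lookup_J:
  "lookup (J n f) \<alpha> =
    (\<Sum>w | w permutes {1..n}. sign w * lookup f (perm_weight (inv w) \<alpha>))"
  unfolding J_def lookup_sum
  by (intro sum.cong refl) (simp add: lookup_perm_laurent)

lemma keys_J:
  assumes "keys f \<subseteq> weights n"
  shows "keys (J n f) \<subseteq> weights n"
proof
  fix \<alpha> assume "\<alpha> \<in> keys (J n f)"
  then have "lookup (J n f) \<alpha> \<noteq> 0" by (simp add: in_keys_iff)
  then obtain w where w: "w permutes {1..n}" "lookup f (perm_weight (inv w) \<alpha>) \<noteq> 0"
    unfolding lookup_J by (metis (mono_tags, lifting) mem_Collect_eq mult_zero_right sum.neutral)
  then have "perm_weight (inv w) \<alpha> \<in> weights n" using assms by (auto simp: in_keys_iff)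
  then have "perm_weight w (perm_weight (inv w) \<alpha>) \<in> weights n"
    using w(1) by (rule perm_weight_in_weights[rotated])
  then show "\<alpha> \<in> weights n" using perm_weight_inverse[OF w(1)] by simp
qed

text \<open>Replacing the summation index \<open>w\<close> by \<open>u \<circ> w\<close> cancels
  \<open>u\<close> in the argument and leaves the factor \<open>sign u\<close>.\<close>

lemma alternating_J:
  assumes "keys f \<subseteq> weights n"
  shows "alternating n (J n f)"
  unfolding alternating_def
proof (intro conjI allI impI keys_J assms)
  fix u \<alpha> assume u: "u permutes {1..n}"
  have *: "sign (u \<circ> w) * lookup f (perm_weight (inv (u \<circ> w)) (perm_weight u \<alpha>)) =
      sign u * (sign w * lookup f (perm_weight (inv w) \<alpha>))" if w: "w permutes {1..n}" for w
  proof -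
    have "bij u" "bij w" using u w permutes_bij by auto
    then have "inv (u \<circ> w) = inv w \<circ> inv u" by (rule o_inv_distrib)
    moreover have "sign (u \<circ> w) = sign u * sign w"
      using u w by (metis finite_atLeastAtMost permutation_permutes sign_compose)
    ultimately show ?thesis
      by (simp add: perm_weight_inverse[OF u]
          flip: perm_weight_compose[OF permutes_inv[OF w] permutes_inv[OF u]])
  qed
  show "lookup (J n f) (perm_weight u \<alpha>) = sign u * lookup (J n f) \<alpha>"
    unfolding lookup_J
    by (subst setum_permutations_compose_left[OF u]) (simp add: sum_distrib_left *)
qed

text \<open>Distinct entries can be sorted into strictly decreasing order, and a strictly decreasing
  integer sequence minus \<open>rho n\<close> is still weakly decreasing.\<close>

lemma sort_weight:
  assumes "\<alpha> \<in> weights n" "inj_on (lookup \<alpha>) {1..n}"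
  obtains w \<mu> where "w permutes {1..n}" "\<mu> \<in> dominant_weights n" "\<alpha> = perm_weight w (\<mu> + rho n)"
proof -
  define a where "a = lookup \<alpha>"
  \<comment> \<open>\<open>r i\<close> is the rank of the entry at position \<open>i\<close>, the
    largest entry having rank 1. Positions outside \<open>{1..n}\<close> are fixed so that
    \<open>r\<close> can be a permutation; its inverse is the sorting permutation.\<close>
  define r where "r i = (if i \<in> {1..n} then card {l \<in> {1..n}. a i \<le> a l} else i)" for i
  have r_less: "r i < r j" if "i \<in> {1..n}" "j \<in> {1..n}" "a j < a i" for i j
  proof -
    have "{l \<in> {1..n}. a i \<le> a l} \<subset> {l \<in> {1..n}. a j \<le> a l}"
    proof (rule psubsetI)
      show "{l \<in> {1..n}. a i \<le> a l} \<subseteq> {l \<in> {1..n}. a j \<le> a l}" using that by auto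
      have "j \<in> {l \<in> {1..n}. a j \<le> a l} - {l \<in> {1..n}. a i \<le> a l}" using that by auto
      then show "{l \<in> {1..n}. a i \<le> a l} \<noteq> {l \<in> {1..n}. a j \<le> a l}" by blast
    qed
    then show ?thesis using that by (simp add: r_def psubset_card_mono)
  qed
  have "inj_on r {1..n}"
  proof (rule inj_onI)
    fix i j assume "i \<in> {1..n}" "j \<in> {1..n}" "r i = r j"
    then have "a i = a j" using r_less by (metis less_irrefl linorder_neqE)
    then show "i = j" using inj_onD[OF assms(2)] \<open>i \<in> _\<close> \<open>j \<in> _\<close> unfolding a_def by blast
  qed
  moreover have "r ` {1..n} \<subseteq> {1..n}"
  proof
    fix k assume "k \<in> r ` {1..n}"
    then obtain i where i: "i \<in> {1..n}" "k = card {l \<in> {1..n}. a i \<le> a l}"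
      by (auto simp: r_def)
    have "{l \<in> {1..n}. a i \<le> a l} \<subseteq> {1..n}" by auto
    then have "k \<le> n" using card_mono[of "{1..n}"] i(2) by fastforce
    moreover have "card {l \<in> {1..n}. a i \<le> a l} > 0" using i(1) by (subst card_gt_0_iff) auto
    ultimately show "k \<in> {1..n}" using i(2) by simp
  qed
  ultimately have "bij_betw r {1..n} {1..n}"
    by (simp add: bij_betw_def endo_inj_surj)
  then have r: "r permutes {1..n}" by (rule bij_imp_permutes) (auto simp: r_def)
  define w where "w = inv r"
  have w: "w permutes {1..n}" "inv w = r" "\<And>i. r (w i) = i"
    using permutes_inv[OF r] permutes_inv_inv[OF r] permutes_inverses[OF r] by (simp_all add: w_def)
  define \<mu> where "\<mu> = perm_weight (inv w) \<alpha> - rho n"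
  have lookup_\<mu>: "lookup \<mu> i = a (w i) - lookup (rho n) i" for i
    by (simp add: \<mu>_def lookup_minus lookup_perm_weight_inv[OF w(1)] a_def)
  have "a (w j) < a (w i)" if "1 \<le> i" "i < j" "j \<le> n" for i j
  proof (rule ccontr)
    have ij: "w i \<in> {1..n}" "w j \<in> {1..n}" using that permutes_in_image[OF w(1)] by auto
    have "a (w i) \<noteq> a (w j)"
      using assms(2) ij that permutes_inj[OF w(1)] unfolding a_def by (metis inj_on_def injD less_irrefl)
    moreover assume "\<not> a (w j) < a (w i)"
    ultimately have "r (w j) < r (w i)" using r_less[OF ij(2,1)] by simp
    then show False using that w(3) by simp
  qed
  \<comment> \<open>By integrality a strict descent is a drop of at least 1, which is exactly the
    drop of \<open>rho n\<close> between neighbours.\<close>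
  then have less: "a (w (Suc i)) + 1 \<le> a (w i)" if "1 \<le> i" "Suc i \<le> n" for i
    using that by (metis lessI zless_imp_add1_zle)
  have mono: "lookup \<mu> j \<le> lookup \<mu> i" if "i \<le> j" "1 \<le> i" "j \<le> n" for i j
    using that
  proof (induction j rule: dec_induct)
    case (step k)
    moreover have "lookup \<mu> (Suc k) \<le> lookup \<mu> k"
      using less[of k] step by (simp add: lookup_\<mu> lookup_rho)
    ultimately show ?case by simp
  qed simp
  have "\<mu> \<in> weights n"
    unfolding \<mu>_def
    by (intro weights_diff rho_in_weights perm_weight_in_weights permutes_inv w assms)
  with mono have "\<mu> \<in> dominant_weights n" by (auto simp: dominant_weights_def)
  moreover have "\<alpha> = perm_weight w (\<mu> + rho n)"
    by (simp add: \<mu>_def perm_weight_inverse[OF w(1)])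
  ultimately show ?thesis using that w(1) by blast
qed

text \<open>A weight with distinct entries lies in the orbit of some \<open>\<mu> + rho n\<close>,
  so its coefficient is known up to sign. A weight with a repeated entry is fixed by a
  transposition, and its coefficient equals its own negative.\<close>

lemma alternating_eq_0:
  assumes "alternating n f" and "\<And>\<mu>. \<mu> \<in> dominant_weights n \<Longrightarrow> lookup f (\<mu> + rho n) = 0"
  shows "f = 0"
proof (rule poly_mapping_eqI, rule ccontr)
  fix \<alpha> assume nz: "lookup f \<alpha> \<noteq> lookup 0 \<alpha>"
  then have \<alpha>: "\<alpha> \<in> weights n" using assms(1) by (auto simp: alternating_def in_keys_iff)
  show False
  proof (cases "inj_on (lookup \<alpha>) {1..n}")
    case True
    then obtain w \<mu> where "w permutes {1..n}" "\<mu> \<in> dominant_weights n"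
      "\<alpha> = perm_weight w (\<mu> + rho n)" using sort_weight \<alpha> by blast
    then show False using assms nz by (simp add: alternating_def)
  next
    case False
    then obtain i j where ij: "i \<in> {1..n}" "j \<in> {1..n}" "i \<noteq> j" "lookup \<alpha> i = lookup \<alpha> j"
      by (auto simp: inj_on_def)
    have t: "transpose i j permutes {1..n}" using ij by (simp add: permutes_swap_id)
    have "perm_weight (transpose i j) \<alpha> = \<alpha>"
      by (rule poly_mapping_eqI)
        (use ij in \<open>auto simp: lookup_perm_weight[OF t] transpose_def\<close>)
    then have "lookup f \<alpha> = - lookup f \<alpha>"
      using assms(1) t ij(3) unfolding alternating_def by (metis mult_minus1 sign_swap_id)
    then show False using nz by simp
  qed
qed

text \<open>Starting from \<open>1 \<le> w 1\<close>, strict increase gives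
  \<open>i \<le> w i\<close> by induction, and a permutation that lowers no point is the
  identity.\<close>

lemma strict_mono_permutes_id:
  assumes w: "w permutes {1..n::nat}"
    and mono: "\<And>i j. 1 \<le> i \<Longrightarrow> i < j \<Longrightarrow> j \<le> n \<Longrightarrow> w i < w j"
  shows "w = id"
proof (rule permutes_natset_ge[OF w], safe)
  fix i assume "i \<in> {1..n}"
  then have "1 \<le> i" "i \<le> n" by auto
  then show "i \<le> w i"
  proof (induction i rule: dec_induct)
    case base
    then show ?case using permutes_in_image[OF w, of 1] by auto
  next
    case (step k)
    then show ?case using mono[of k "Suc k"] by simp
  qed
qed

text \<open>Both shifted weights are strictly decreasing, so a permutation carrying one to the other
  preserves the order of positions. Hence only \<open>w = id\<close> can contribute to the
  sum.\<close>

lemma lookup_J_xpow_dominant: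
  assumes \<mu>: "\<mu> \<in> dominant_weights n" and \<nu>: "\<nu> \<in> dominant_weights n"
  shows "lookup (J n (xpow (\<mu> + rho n))) (\<nu> + rho n) = (if \<nu> = \<mu> then 1 else 0)"
proof -
  have *: "w = id \<and> \<nu> = \<mu>"
    if w: "w permutes {1..n}" and eq: "perm_weight (inv w) (\<nu> + rho n) = \<mu> + rho n" for w
  proof -
    have eq': "lookup (\<nu> + rho n) (w i) = lookup (\<mu> + rho n) i" for i
      using eq lookup_perm_weight_inv[OF w] by metis
    have "w i < w j" if "1 \<le> i" "i < j" "j \<le> n" for i j
    proof (rule ccontr)
      assume "\<not> w i < w j"
      moreover have "w i \<noteq> w j" using that permutes_inj[OF w] by (metis injD less_irrefl)
      moreover have "w i \<in> {1..n}" "w j \<in> {1..n}" using that permutes_in_image[OF w] by auto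
      ultimately have "lookup (\<nu> + rho n) (w i) < lookup (\<nu> + rho n) (w j)"
        using dominant_add_rho_less[OF \<nu>, of "w j" "w i"] by auto
      then show False using dominant_add_rho_less[OF \<mu> that] eq' by simp
    qed
    then have "w = id" by (rule strict_mono_permutes_id[OF w])
    then show ?thesis using eq by (simp add: inv_id)
  qed
  have "sign w * lookup (xpow (\<mu> + rho n)) (perm_weight (inv w) (\<nu> + rho n)) =
      (if w = id then if \<nu> = \<mu> then 1 else 0 else 0)" if "w permutes {1..n}" for w
    using *[OF that] by (auto simp: inv_id)
  then have "lookup (J n (xpow (\<mu> + rho n))) (\<nu> + rho n) =
      (\<Sum>w | w permutes {1..n}. if w = id then if \<nu> = \<mu> then 1 else 0 else 0)"
    unfolding lookup_J by (intro sum.cong refl) simp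
  also have "\<dots> = (if \<nu> = \<mu> then 1 else 0)"
    by (subst sum.delta) (simp_all add: finite_permutations permutes_id)
  finally show ?thesis .
qed

lemma finite_alternating_support:
  "finite {\<mu> \<in> dominant_weights n. lookup f (\<mu> + rho n) \<noteq> 0}"
proof (rule finite_imageD)
  show "finite ((\<lambda>\<mu>. \<mu> + rho n) ` {\<mu> \<in> dominant_weights n. lookup f (\<mu> + rho n) \<noteq> 0})"
    by (rule finite_subset[OF _ finite_keys[of f]]) (auto simp: in_keys_iff)
qed (simp add: inj_on_def)

text \<open>This contains the linear independence of the \<open>J n (xpow (\<mu> + rho n))\<close>;
  uniqueness of the Schur coefficients rests on it.\<close>

lemma lookup_sum_J_dominant:
  assumes "finite M" "M \<subseteq> dominant_weights n" "\<nu> \<in> dominant_weights n"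
  shows "lookup (\<Sum>\<mu>\<in>M. frag_cmul (c \<mu>) (J n (xpow (\<mu> + rho n)))) (\<nu> + rho n) =
    (if \<nu> \<in> M then c \<nu> else 0)"
proof -
  have "lookup (\<Sum>\<mu>\<in>M. frag_cmul (c \<mu>) (J n (xpow (\<mu> + rho n)))) (\<nu> + rho n) =
      (\<Sum>\<mu>\<in>M. if \<nu> = \<mu> then c \<mu> else 0)"
    unfolding lookup_sum
    by (intro sum.cong refl) (use assms in \<open>auto simp: lookup_J_xpow_dominant subset_iff\<close>)
  then show ?thesis using assms(1) by (simp add: sum.delta)
qed

lemma keys_xpow_dominant:
  "\<mu> \<in> dominant_weights n \<Longrightarrow> keys (xpow (\<mu> + rho n)) \<subseteq> weights n"
  by (simp add: weights_add dominant_in_weights rho_in_weights)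

text \<open>The difference of the two sides is alternating and has coefficient 0 at every
  \<open>\<nu> + rho n\<close> with \<open>\<nu>\<close> dominant, so it vanishes.\<close>

lemma alternating_expansion:
  assumes "alternating n f"
  shows "f = (\<Sum>\<mu> | \<mu> \<in> dominant_weights n \<and> lookup f (\<mu> + rho n) \<noteq> 0.
    frag_cmul (lookup f (\<mu> + rho n)) (J n (xpow (\<mu> + rho n))))" (is "f = ?S")
proof -
  have "f - ?S = 0"
  proof (rule alternating_eq_0)
    show "alternating n (f - ?S)"
      by (intro alternating_diff alternating_sum alternating_cmul alternating_J assms)
        (use keys_xpow_dominant in auto)
    fix \<nu> assume "\<nu> \<in> dominant_weights n"
    then show "lookup (f - ?S) (\<nu> + rho n) = 0"
      unfolding lookup_minus
      by (subst lookup_sum_J_dominant[OF finite_alternating_support]) auto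
  qed
  then show ?thesis by simp
qed

subsection \<open>The Vandermonde product\<close>

lemma perm_weight_eps:
  assumes "w permutes {1..n}"
  shows "perm_weight w (eps i) = eps (w i)"
  by (rule poly_mapping_eqI)
    (auto simp: lookup_perm_weight[OF assms] permutes_inv_eq[OF assms])

lemma perm_laurent_xpow [simp]: "perm_laurent w (xpow \<alpha>) = xpow (perm_weight w \<alpha>)"
  by (simp add: perm_laurent_def)

lemma perm_laurent_id [simp]: "perm_laurent id f = f"
  by (rule poly_mapping_eqI) (simp only: lookup_perm_laurent[OF permutes_id] inv_id perm_weight_id)

lemma perm_laurent_diff: "perm_laurent w (f - g) = perm_laurent w f - perm_laurent w g"
  by (simp add: perm_laurent_def frag_extend_diff)

lemma perm_laurent_cmul: "perm_laurent w (frag_cmul c f) = frag_cmul c (perm_laurent w f)"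
  by (simp add: perm_laurent_def frag_extend_cmul)

lemma perm_laurent_mult:
  assumes "w permutes {1..n}"
  shows "perm_laurent w (f * g) = perm_laurent w f * perm_laurent w g"
  unfolding perm_laurent_def
  by (rule frag_extend_single_mult) (rule perm_weight_add[OF assms])

lemma perm_laurent_prod:
  assumes "w permutes {1..n}"
  shows "perm_laurent w (\<Prod>i\<in>I. f i) = (\<Prod>i\<in>I. perm_laurent w (f i))"
proof -
  have "perm_weight w 0 = 0"
    by (rule poly_mapping_eqI) (simp add: lookup_perm_weight[OF assms])
  then show ?thesis
    unfolding perm_laurent_def
    by (rule frag_extend_single_prod[rotated]) (rule perm_weight_add[OF assms])
qed

lemma perm_laurent_compose:
  assumes "u permutes {1..n}" "v permutes {1..n}"
  shows "perm_laurent (u \<circ> v) f = perm_laurent u (perm_laurent v f)"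
proof -
  have "perm_laurent u (perm_laurent v f) =
      frag_extend ((\<lambda>\<alpha>. xpow (perm_weight u \<alpha>)) \<circ> perm_weight v) f"
    unfolding perm_laurent_def by (subst frag_extend_compose[symmetric]) (simp add: o_def)
  then show ?thesis by (simp add: perm_laurent_def o_def perm_weight_compose[OF assms])
qed

text \<open>On monomials, \<open>merge_weight k l\<close> is the substitution \<open>x\<^sub>l := x\<^sub>k\<close>; its kernel on Laurent
  polynomials is the ideal generated by \<open>x\<^sub>k - x\<^sub>l\<close>, which is prime because the substitution
  is a ring homomorphism into an integral domain.\<close>

definition merge_weight :: "nat \<Rightarrow> nat \<Rightarrow> weight \<Rightarrow> weight"
  where "merge_weight k l \<alpha> = \<alpha> + frag_cmul (lookup \<alpha> l) (eps k - eps l)"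

definition merge :: "nat \<Rightarrow> nat \<Rightarrow> laurent \<Rightarrow> laurent"
  where "merge k l = frag_extend (\<lambda>\<alpha>. xpow (merge_weight k l \<alpha>))"

abbreviation root_diff :: "nat \<times> nat \<Rightarrow> laurent"
  where "root_diff \<equiv> (\<lambda>(i, j). xpow (eps i) - xpow (eps j))"

lemma merge_weight_add: "merge_weight k l (\<alpha> + \<beta>) = merge_weight k l \<alpha> + merge_weight k l \<beta>"
  by (simp add: merge_weight_def lookup_add frag_cmul_distrib)

lemma merge_weight_eps:
  "merge_weight k l (eps i) = (if i = l then eps k else eps i)"
  by (simp add: merge_weight_def)

lemma merge_diff: "merge k l (f - g) = merge k l f - merge k l g"
  by (simp add: merge_def frag_extend_diff)

lemma merge_xpow: "merge k l (xpow \<alpha>) = xpow (merge_weight k l \<alpha>)"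
  by (simp add: merge_def)

lemma merge_mult: "merge k l (f * g) = merge k l f * merge k l g"
  unfolding merge_def by (rule frag_extend_single_mult) (rule merge_weight_add)

lemma merge_prod: "merge k l (\<Prod>i\<in>I. f i) = (\<Prod>i\<in>I. merge k l (f i))"
  unfolding merge_def
  by (rule frag_extend_single_prod) (rule merge_weight_add, simp add: merge_weight_def)

text \<open>The Laurent version of the divisibility of \<open>x^c - y^c\<close> by
  \<open>x - y\<close>: the difference telescopes, and the induction runs both ways because
  \<open>c\<close> may be negative.\<close>

lemma root_diff_dvd_xpow_shift:
  "root_diff (k, l) dvd xpow \<alpha> - xpow (\<alpha> + frag_cmul c (eps k - eps l))"
proof -
  let ?x = "\<lambda>c. xpow (\<alpha> + frag_cmul c (eps k - eps l))"
  have step: "root_diff (k, l) dvd ?x c - ?x (c + 1)" for c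
  proof -
    have "?x c - ?x (c + 1) =
        root_diff (k, l) * - xpow (\<alpha> + frag_cmul c (eps k - eps l) - eps l)"
      by (simp add: left_diff_distrib mult_single frag_cmul_distrib algebra_simps)
    then show ?thesis by (rule dvdI)
  qed
  show ?thesis
  proof (induction c rule: int_induct[where k = 0])
    case (step1 i)
    then show ?case using dvd_add[OF step1(2) step[of i]] by simp
  next
    case (step2 i)
    then show ?case using dvd_diff[OF step2(2) step[of "i - 1"]] by simp
  qed simp
qed

text \<open>By linearity \<open>f\<close> may be taken to be a monomial, and there
  \<open>merge\<close> shifts the exponent by a multiple of \<open>eps k - eps l\<close>.\<close>

lemma root_diff_dvd_diff_merge: "root_diff (k, l) dvd f - merge k l f"
  using subset_UNIV
proof (induction f rule: frag_induction)
  case (one \<alpha>)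
  then show ?case
    using root_diff_dvd_xpow_shift[of k l \<alpha>] by (simp add: merge_def merge_weight_def)
next
  case (diff f g)
  then have "root_diff (k, l) dvd (f - merge k l f) - (g - merge k l g)" by (rule dvd_diff)
  then show ?case by (simp add: merge_diff algebra_simps)
qed (simp add: merge_def)

lemma root_diff_dvd: "merge k l f = 0 \<Longrightarrow> root_diff (k, l) dvd f"
  using root_diff_dvd_diff_merge[of k l f] by simp

text \<open>Once the two variables are identified, exchanging them has no effect. So
  \<open>merge k l f\<close> equals its own negative, and integer coefficients have no
  2-torsion.\<close>

lemma merge_eq_0:
  assumes "k \<in> {1..n}" "l \<in> {1..n}" "perm_laurent (transpose k l) f = - f"
  shows "merge k l f = 0"
proof -
  have t: "transpose k l permutes {1..n}" using assms by (simp add: permutes_swap_id)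
  have "merge_weight k l (perm_weight (transpose k l) \<alpha>) = merge_weight k l \<alpha>" for \<alpha>
    by (rule poly_mapping_eqI)
      (auto simp: merge_weight_def lookup_add lookup_minus lookup_perm_weight[OF t] transpose_def)
  then have "merge k l (perm_laurent (transpose k l) f) = merge k l f"
    unfolding merge_def perm_laurent_def
    using frag_extend_compose[of "\<lambda>\<alpha>. xpow (merge_weight k l \<alpha>)" "perm_weight (transpose k l)" f]
    by (simp add: o_def)
  then have "merge k l f = - merge k l f"
    by (simp add: assms(3) merge_def frag_extend_minus)
  then show ?thesis
    by (metis equal_neg_zero lookup_uminus poly_mapping_eqI lookup_zero)
qed

section \<open>The Vandermonde product as a divisor of alternating polynomials\<close>

definition index_pairs :: "nat \<Rightarrow> (nat \<times> nat) set"
  where "index_pairs n = {(i, j). 1 \<le> i \<and> i < j \<and> j \<le> n}"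

definition vandermonde :: "nat \<Rightarrow> laurent"
  where "vandermonde n = (\<Prod>p\<in>index_pairs n. root_diff p)"

lemma finite_index_pairs: "finite (index_pairs n)"
  by (rule finite_subset[of _ "{1..n} \<times> {1..n}"]) (auto simp: index_pairs_def)

text \<open>The substitution identifies only the variables \<open>k\<close> and \<open>l\<close>.
  Since pairs are listed with the smaller index first, no other factor collapses, and a product of
  nonzero elements of an integral domain is nonzero.\<close>

lemma merge_prod_root_diff_nonzero:
  assumes "finite S" "S \<subseteq> index_pairs n" "(k, l) \<in> index_pairs n" "(k, l) \<notin> S"
  shows "merge k l (\<Prod>p\<in>S. root_diff p) \<noteq> 0"
proof -
  have "merge k l (root_diff (i, j)) \<noteq> 0" if "(i, j) \<in> S" for i j
  proof -
    have "i < j" "k < l" "(i, j) \<noteq> (k, l)" using assms that by (auto simp: index_pairs_def)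
    then show ?thesis
      by (auto simp: merge_diff merge_xpow merge_weight_eps frag_of_eq)
  qed
  then show ?thesis using assms(1) by (auto simp: merge_prod)
qed

text \<open>Factors are split off one at a time. If \<open>f\<close> is the product over
  \<open>S\<close> times \<open>g\<close>, then \<open>merge k l\<close> kills \<open>f\<close> but
  not the product, so it kills \<open>g\<close>, and the new factor divides
  \<open>g\<close>.\<close>

lemma prod_root_diff_dvd_alternating:
  assumes f: "alternating n f" and "finite S" "S \<subseteq> index_pairs n"
  shows "(\<Prod>p\<in>S. root_diff p) dvd f"
  using assms(2,3)
proof (induction S rule: finite_induct)
  case (insert p S)
  obtain k l where p: "p = (k, l)" by force
  then have kl: "k \<in> {1..n}" "l \<in> {1..n}" "k \<noteq> l"
    using insert.prems by (auto simp: index_pairs_def)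
  from insert obtain g where g: "f = (\<Prod>p\<in>S. root_diff p) * g" by (auto elim: dvdE)
  have "transpose k l permutes {1..n}" using kl by (simp add: permutes_swap_id)
  then have "perm_laurent (transpose k l) f = - f"
    using alternating_perm_laurent[OF f] kl(3) by (simp add: sign_swap_id)
  then have "merge k l f = 0" by (rule merge_eq_0[OF kl(1,2)])
  moreover have "merge k l (\<Prod>p\<in>S. root_diff p) \<noteq> 0"
    using merge_prod_root_diff_nonzero insert p by blast
  ultimately have "merge k l g = 0" by (simp add: g merge_mult)
  then have "root_diff p dvd g" unfolding p by (rule root_diff_dvd)
  then have "(\<Prod>p\<in>S. root_diff p) * root_diff p dvd (\<Prod>p\<in>S. root_diff p) * g"
    by (rule mult_dvd_mono[OF dvd_refl])
  then show ?case by (simp only: prod.insert[OF insert.hyps] g mult.commute)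
qed simp

lemma vandermonde_nonzero: "vandermonde n \<noteq> 0"
  using finite_index_pairs by (auto simp: vandermonde_def index_pairs_def frag_of_eq)

text \<open>A transposition maps the Vandermonde product to itself up to a sign \<open>e\<close>. If \<open>e\<close> were \<open>1\<close>,
  then the product of the remaining factors would be alternating under the transposition of
  \<open>k\<close> and \<open>l\<close>, hence divisible by \<open>x\<^sub>k - x\<^sub>l\<close> a second time; no count of inversions is needed.\<close>

lemma perm_laurent_transpose_vandermonde:
  assumes kl: "(k, l) \<in> index_pairs n"
  shows "perm_laurent (transpose k l) (vandermonde n) = - vandermonde n"
proof -
  let ?t = "transpose k l" and ?P = "index_pairs n"
  have kl': "k \<in> {1..n}" "l \<in> {1..n}" "k < l" using kl by (auto simp: index_pairs_def)
  have t: "?t permutes {1..n}" using kl' by (simp add: permutes_swap_id)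
  have t_in: "?t i \<in> {1..n} \<longleftrightarrow> i \<in> {1..n}" for i using permutes_in_image[OF t] .
  \<comment> \<open>\<open>h\<close> is the action of the transposition on pairs, with the result
    written smaller index first; \<open>s\<close> below records the sign produced by that
    reordering.\<close>
  define h where "h = (\<lambda>(i, j). (min (?t i) (?t j), max (?t i) (?t j)))"
  have h_in: "h p \<in> ?P" if "p \<in> ?P" for p
  proof -
    obtain i j where p: "p = (i, j)" by force
    then have "i \<in> {1..n}" "j \<in> {1..n}" "i \<noteq> j" using that by (auto simp: index_pairs_def)
    moreover from this have "?t i \<noteq> ?t j" using injD[OF permutes_inj[OF t]] by blast
    ultimately show ?thesis
      using t_in[of i] t_in[of j] by (auto simp: p h_def index_pairs_def min_def max_def)
  qed
  have hh: "h (h p) = p" if "p \<in> ?P" for p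
    using that by (auto simp: h_def index_pairs_def min_def max_def split: if_splits)
  have bij: "bij_betw h ?P ?P"
    by (rule bij_betw_byWitness[where f' = h]) (use h_in hh in auto)
  define s :: "nat \<times> nat \<Rightarrow> laurent" where "s = (\<lambda>(i, j). if ?t i < ?t j then 1 else - 1)"
  have factor: "perm_laurent ?t (root_diff p) = s p * root_diff (h p)" for p
    by (cases p) (auto simp: s_def h_def perm_laurent_diff perm_weight_eps[OF t] min_def max_def)
  define e where "e = (\<Prod>p\<in>?P. s p)"
  have e: "e = 1 \<or> e = - 1"
  proof -
    have "(\<Prod>p\<in>S. s p) = 1 \<or> (\<Prod>p\<in>S. s p) = - 1" for S
      by (induction S rule: infinite_finite_induct) (auto simp: s_def split: if_splits)
    then show ?thesis by (simp add: e_def)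
  qed
  have perm_V: "perm_laurent ?t (vandermonde n) = e * vandermonde n"
    unfolding vandermonde_def perm_laurent_prod[OF t] factor prod.distrib e_def
    using prod.reindex_bij_betw[OF bij, of root_diff] by simp
  moreover have "e \<noteq> 1"
  proof
    assume "e = 1"
    define U where "U = (\<Prod>p\<in>?P - {(k, l)}. root_diff p)"
    have V: "vandermonde n = root_diff (k, l) * U"
      unfolding vandermonde_def U_def by (rule prod.remove[OF finite_index_pairs kl])
    have "perm_laurent ?t (root_diff (k, l)) = - root_diff (k, l)"
      by (simp add: perm_laurent_diff perm_weight_eps[OF t])
    then have "root_diff (k, l) * U = - root_diff (k, l) * perm_laurent ?t U"
      using perm_V by (simp only: V perm_laurent_mult[OF t] \<open>e = 1\<close> mult_1_left)
    then have "root_diff (k, l) * (perm_laurent ?t U + U) = 0"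
      by (simp add: distrib_left algebra_simps)
    moreover have "root_diff (k, l) \<noteq> 0" using kl' by (simp add: frag_of_eq)
    ultimately have "perm_laurent ?t U = - U" by (metis mult_eq_0_iff eq_neg_iff_add_eq_0)
    then have "merge k l U = 0" by (rule merge_eq_0[OF kl'(1,2)])
    moreover have "merge k l U \<noteq> 0"
      unfolding U_def
      by (rule merge_prod_root_diff_nonzero) (use kl finite_index_pairs in auto)
    ultimately show False by contradiction
  qed
  ultimately show ?thesis using e by auto
qed

text \<open>Transpositions generate the symmetric group, and composing with one changes the sign of
  both sides.\<close>

lemma perm_laurent_vandermonde:
  assumes "w permutes {1..n}"
  shows "perm_laurent w (vandermonde n) = frag_cmul (sign w) (vandermonde n)"
  using assms finite_atLeastAtMost
proof (induction w rule: permutes_induct)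
  case id
  show ?case by (simp only: perm_laurent_id sign_id frag_cmul_one)
next
  case (swap a b w)
  then have t: "transpose a b permutes {1..n}" by (simp add: permutes_swap_id)
  have "(a, b) \<in> index_pairs n \<or> (b, a) \<in> index_pairs n"
    using swap by (auto simp: index_pairs_def)
  then have "perm_laurent (transpose a b) (vandermonde n) = - vandermonde n"
    using perm_laurent_transpose_vandermonde transpose_commute by metis
  moreover have "sign (transpose a b \<circ> w) = - sign w"
    using swap t by (metis finite_atLeastAtMost permutation_permutes sign_compose sign_swap_id mult_minus1)
  ultimately show ?case
    by (simp only: perm_laurent_compose[OF t swap.hyps(4)] swap.IH perm_laurent_cmul)
      (simp add: frag_cmul_eq_mult)
qed

text \<open>Every factor contributes one variable of its pair with exponent 1, and the variable with
  index 1 occurs only as a first component. These bounds confine the exponents of the Vandermonde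
  product.\<close>

lemma keys_prod_root_diff:
  assumes "finite S" "S \<subseteq> index_pairs n" "\<alpha> \<in> keys (\<Prod>p\<in>S. root_diff p)"
  shows "\<alpha> \<in> weights n" and "0 \<le> lookup \<alpha> i" and "lookup \<alpha> 1 \<le> int (card {p \<in> S. fst p = 1})"
proof -
  have "\<alpha> \<in> weights n \<and> 0 \<le> lookup \<alpha> i \<and> lookup \<alpha> 1 \<le> int (card {p \<in> S. fst p = 1})"
    using assms
  proof (induction S arbitrary: \<alpha> rule: finite_induct)
    case empty
    then show ?case by (simp add: weights_iff)
  next
    case (insert p S)
    obtain k l where p: "p = (k, l)" by force
    have kl: "1 \<le> k" "k < l" "l \<le> n" using insert.prems(1) p by (auto simp: index_pairs_def)
    have "\<alpha> \<in> keys (root_diff p * (\<Prod>p\<in>S. root_diff p))"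
      using insert.prems(2) by (simp only: prod.insert[OF insert.hyps])
    then obtain \<beta> \<gamma> where \<alpha>: "\<alpha> = \<beta> + \<gamma>" and \<beta>: "\<beta> \<in> keys (root_diff p)"
      and \<gamma>: "\<gamma> \<in> keys (\<Prod>p\<in>S. root_diff p)"
      using keys_mult by blast
    have \<beta>': "\<beta> = eps k \<or> \<beta> = eps l"
      using \<beta> keys_diff[of "xpow (eps k)" "xpow (eps l)"] by (auto simp: p)
    have "card {q \<in> insert p S. fst q = 1} = card {q \<in> S. fst q = 1} + (if k = 1 then 1 else 0)"
    proof -
      have "{q \<in> insert p S. fst q = 1} =
          (if k = 1 then insert p {q \<in> S. fst q = 1} else {q \<in> S. fst q = 1})"
        by (auto simp: p)
      then show ?thesis using insert.hyps by simp
    qed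
    moreover have "lookup \<beta> 1 \<le> (if k = 1 then 1 else 0)" "0 \<le> lookup \<beta> i" "\<beta> \<in> weights n"
      using \<beta>' kl by (auto simp: weights_iff)
    ultimately show ?case
      using insert.IH[OF _ \<gamma>] insert.prems(1) by (auto simp: \<alpha> lookup_add weights_add)
  qed
  then show "\<alpha> \<in> weights n" "0 \<le> lookup \<alpha> i" "lookup \<alpha> 1 \<le> int (card {p \<in> S. fst p = 1})"
    by auto
qed

lemma alternating_vandermonde: "alternating n (vandermonde n)"
  unfolding alternating_def
proof (intro conjI allI impI subsetI)
  fix \<alpha> assume "\<alpha> \<in> keys (vandermonde n)"
  then show "\<alpha> \<in> weights n"
    unfolding vandermonde_def using keys_prod_root_diff(1)[OF finite_index_pairs order_refl] by blast
next
  fix w \<alpha> assume w: "w permutes {1..n}"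
  have "sign (inv w) = sign w"
    using w permutation_permutes sign_inverse by blast
  moreover have "lookup (perm_laurent (inv w) (vandermonde n)) \<alpha> =
      lookup (vandermonde n) (perm_weight w \<alpha>)"
    by (simp add: lookup_perm_laurent[OF permutes_inv[OF w]] permutes_inv_inv[OF w])
  ultimately show "lookup (vandermonde n) (perm_weight w \<alpha>) = sign w * lookup (vandermonde n) \<alpha>"
    using perm_laurent_vandermonde[OF permutes_inv[OF w]] by simp
qed

text \<open>Both sides are alternating, and the exponent bounds leave \<open>rho n\<close> as the
  only strictly decreasing exponent possible. The scalar stays unevaluated: divisibility and
  nonvanishing follow from the equation alone.\<close>

lemma vandermonde_eq_cmul_J:
  "vandermonde n = frag_cmul (lookup (vandermonde n) (rho n)) (J n (xpow (rho n)))"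
proof -
  let ?V = "vandermonde n"
  have 0: "0 \<in> dominant_weights n" by (simp add: dominant_weights_def weights_iff)
  have "?V - frag_cmul (lookup ?V (rho n)) (J n (xpow (rho n))) = 0"
  proof (rule alternating_eq_0)
    show "alternating n (?V - frag_cmul (lookup ?V (rho n)) (J n (xpow (rho n))))"
      by (intro alternating_diff alternating_cmul alternating_vandermonde alternating_J)
        (simp add: rho_in_weights)
    fix \<mu> assume \<mu>: "\<mu> \<in> dominant_weights n"
    have "lookup ?V (\<mu> + rho n) = 0" if "\<mu> \<noteq> 0"
    proof (rule ccontr)
      assume "lookup ?V (\<mu> + rho n) \<noteq> 0"
      then have keys: "\<mu> + rho n \<in> keys (\<Prod>p\<in>index_pairs n. root_diff p)"
        by (simp add: vandermonde_def in_keys_iff)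
      note bounds = keys_prod_root_diff(2,3)[OF finite_index_pairs order_refl keys]
      have "lookup \<mu> i = 0" for i
      proof (cases "i \<in> {1..n}")
        case True
        \<comment> \<open>At most \<open>n - 1\<close> pairs begin with 1, which gives
          \<open>lookup \<mu> 1 \<le> 0\<close>. Nonnegativity at position \<open>n\<close>, where
          \<open>rho n\<close> is 0, and dominance then squeeze all entries to 0.\<close>
        have "{p \<in> index_pairs n. fst p = 1} \<subseteq> {1} \<times> {2..n}" by (auto simp: index_pairs_def)
        from card_mono[OF _ this] have "card {p \<in> index_pairs n. fst p = 1} \<le> n - 1" by simp
        then have "int (card {p \<in> index_pairs n. fst p = 1}) \<le> int n - 1"
          using True by (simp add: of_nat_diff le_diff_conv2 flip: of_nat_le_iff)
        then have "lookup \<mu> 1 \<le> 0" using bounds(2) True by (simp add: lookup_add lookup_rho)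
        moreover have "0 \<le> lookup \<mu> n" using bounds(1)[of n] True by (simp add: lookup_add lookup_rho)
        moreover have "lookup \<mu> i \<le> lookup \<mu> 1" "lookup \<mu> n \<le> lookup \<mu> i"
          using \<mu> True by (auto simp: dominant_weights_def)
        ultimately show ?thesis by simp
      qed (use dominant_in_weights[OF \<mu>] in \<open>simp add: weights_iff\<close>)
      with that show False by (simp add: poly_mapping_eqI)
    qed
    then show "lookup (?V - frag_cmul (lookup ?V (rho n)) (J n (xpow (rho n)))) (\<mu> + rho n) = 0"
      using lookup_J_xpow_dominant[OF 0 \<mu>] by (auto simp: lookup_minus)
  qed
  then show ?thesis by simp
qed

lemma J_rho_nonzero: "J n (xpow (rho n)) \<noteq> 0"
  using vandermonde_eq_cmul_J[of n] vandermonde_nonzero[of n] by force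

lemma J_rho_dvd_alternating:
  assumes "alternating n f"
  shows "J n (xpow (rho n)) dvd f"
proof -
  have "J n (xpow (rho n)) dvd vandermonde n"
    by (subst vandermonde_eq_cmul_J) (simp add: frag_cmul_eq_mult)
  also have "vandermonde n dvd f"
    unfolding vandermonde_def
    by (rule prod_root_diff_dvd_alternating[OF assms finite_index_pairs order_refl])
  finally show ?thesis .
qed

subsection \<open>Coefficients in the Schur basis\<close>

lemma lookup_frag_of_mult:
  fixes \<delta> :: "'a::ab_group_add"
  shows "lookup (frag_of \<delta> * f) \<alpha> = lookup f (\<alpha> - \<delta>)"
  using subset_UNIV
  by (induction f rule: frag_induction)
    (auto simp: right_diff_distrib lookup_minus mult_single algebra_simps)

lemma keys_xpow_mult:
  assumes "\<delta> \<in> weights n" "keys f \<subseteq> weights n"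
  shows "keys (xpow \<delta> * f) \<subseteq> weights n"
  using keys_mult[of "xpow \<delta>" f] assms weights_add by auto blast

text \<open>This resolves the definite description in \<open>Pi_op\<close>: divisibility of
  alternating polynomials gives existence, cancellation of the nonzero
  \<open>J n (xpow (rho n))\<close> gives uniqueness.\<close>

lemma J_rho_mult_Pi_op:
  assumes "keys f \<subseteq> weights n"
  shows "J n (xpow (rho n)) * Pi_op n f = J n (xpow (rho n) * f)"
proof -
  have "alternating n (J n (xpow (rho n) * f))"
    by (intro alternating_J keys_xpow_mult rho_in_weights assms)
  then have "J n (xpow (rho n)) dvd J n (xpow (rho n) * f)" by (rule J_rho_dvd_alternating)
  then obtain g where g: "J n (xpow (rho n)) * g = J n (xpow (rho n) * f)" by (metis dvdE)
  then have "\<exists>!g. J n (xpow (rho n)) * g = J n (xpow (rho n) * f)"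
    using J_rho_nonzero[of n] by (metis mult_left_cancel)
  then show ?thesis unfolding Pi_op_def by (rule theI')
qed

lemma J_rho_mult_schur:
  assumes "\<mu> \<in> dominant_weights n"
  shows "J n (xpow (rho n)) * schur n \<mu> = J n (xpow (\<mu> + rho n))"
  using J_rho_mult_Pi_op[of "xpow \<mu>" n] dominant_in_weights[OF assms]
  by (simp add: schur_def mult_single add.commute)

lemma J_rho_mult_schur_sum:
  assumes "M \<subseteq> dominant_weights n"
  shows "J n (xpow (rho n)) * (\<Sum>\<mu>\<in>M. frag_cmul (c \<mu>) (schur n \<mu>)) =
    (\<Sum>\<mu>\<in>M. frag_cmul (c \<mu>) (J n (xpow (\<mu> + rho n))))"
  unfolding sum_distrib_left
  by (intro sum.cong refl)
    (use assms in \<open>auto simp: frag_cmul_eq_mult mult.left_commute simp flip: J_rho_mult_schur\<close>)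

text \<open>Both directions compare expansions after multiplication by
  \<open>J n (xpow (rho n))\<close>: left to right is uniqueness of the coefficients, right to left
  is existence. The finiteness conjunct guards against the default value 0 of a sum over an infinite
  set.\<close>

lemma Pi_op_eq_schur_sum_iff:
  assumes f: "keys f \<subseteq> weights n"
  shows "finite {\<mu> \<in> dominant_weights n. c \<mu> \<noteq> 0} \<and>
      Pi_op n f = (\<Sum>\<mu> | \<mu> \<in> dominant_weights n \<and> c \<mu> \<noteq> 0. frag_cmul (c \<mu>) (schur n \<mu>)) \<longleftrightarrow>
    (\<forall>\<nu>\<in>dominant_weights n. c \<nu> = lookup (J n (xpow (rho n) * f)) (\<nu> + rho n))"
    (is "finite ?M \<and> _ = ?S \<longleftrightarrow> (\<forall>\<nu>\<in>_. _ = lookup ?A _)")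
proof (intro iffI conjI ballI)
  fix \<nu> assume \<nu>: "\<nu> \<in> dominant_weights n" and h: "finite ?M \<and> Pi_op n f = ?S"
  then have "?A = (\<Sum>\<mu>\<in>?M. frag_cmul (c \<mu>) (J n (xpow (\<mu> + rho n))))"
    using J_rho_mult_Pi_op[OF f] J_rho_mult_schur_sum[of ?M n c] by auto
  then have "lookup ?A (\<nu> + rho n) = (if \<nu> \<in> ?M then c \<nu> else 0)"
    using lookup_sum_J_dominant[of ?M n \<nu> c] h \<nu> by auto
  then show "c \<nu> = lookup ?A (\<nu> + rho n)" using \<nu> by simp
next
  assume c: "\<forall>\<nu>\<in>dominant_weights n. c \<nu> = lookup ?A (\<nu> + rho n)"
  then have M: "?M = {\<mu> \<in> dominant_weights n. lookup ?A (\<mu> + rho n) \<noteq> 0}" by auto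
  then show "finite ?M" using finite_alternating_support by simp
  have "alternating n ?A"
    by (intro alternating_J keys_xpow_mult rho_in_weights f)
  then have "?A = (\<Sum>\<mu>\<in>?M. frag_cmul (lookup ?A (\<mu> + rho n)) (J n (xpow (\<mu> + rho n))))"
    unfolding M by (rule alternating_expansion)
  also have "\<dots> = (\<Sum>\<mu>\<in>?M. frag_cmul (c \<mu>) (J n (xpow (\<mu> + rho n))))"
    by (rule sum.cong) (use c in auto)
  also have "\<dots> = J n (xpow (rho n)) * ?S"
    by (rule J_rho_mult_schur_sum[symmetric]) auto
  finally have "J n (xpow (rho n)) * Pi_op n f = J n (xpow (rho n)) * ?S"
    by (simp add: J_rho_mult_Pi_op[OF f])
  then show "Pi_op n f = ?S" using J_rho_nonzero by simp
qed

subsection \<open>Coefficients of the generating function\<close>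

text \<open>Splitting off one factor, the Cauchy product distributes the degree between the exponent
  at \<open>p\<close> and the exponents on the remaining set. Extensional functions make each choice
  of exponents count once.\<close>

lemma fps_nth_prod:
  fixes F :: "'b \<Rightarrow> 'a::comm_semiring_1 fps"
  assumes "finite R"
  shows "fps_nth (\<Prod>p\<in>R. F p) d =
    (\<Sum>m | m \<in> R \<rightarrow>\<^sub>E (UNIV :: nat set) \<and> sum m R = d. \<Prod>p\<in>R. fps_nth (F p) (m p))"
  using assms
proof (induction R arbitrary: d rule: finite_induct)
  case empty
  have "{m. m \<in> {} \<rightarrow>\<^sub>E (UNIV :: nat set) \<and> sum m {} = d} = (if d = 0 then {\<lambda>x. undefined} else {})"
    by auto
  then show ?case by simp
next
  case (insert p R)
  let ?S = "\<lambda>R d. {m. m \<in> R \<rightarrow>\<^sub>E (UNIV :: nat set) \<and> sum m R = d}"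
  have fin: "finite (?S R e)" for e
  proof (rule finite_subset)
    show "?S R e \<subseteq> R \<rightarrow>\<^sub>E {..e}"
      using insert.hyps(1) by (auto simp: PiE_def intro: member_le_sum)
  qed (use insert.hyps(1) in \<open>auto intro: finite_PiE\<close>)
  have upd: "sum (m(p := i)) R = sum m R" "(\<Prod>q\<in>R. fps_nth (F q) ((m(p := i)) q)) = (\<Prod>q\<in>R. fps_nth (F q) (m q))"
    for m :: "'b \<Rightarrow> nat" and i
    using insert.hyps(2) by (auto intro!: sum.cong prod.cong)
  have "fps_nth (\<Prod>q\<in>insert p R. F q) d =
      (\<Sum>i=0..d. \<Sum>m\<in>?S R (d - i). fps_nth (F p) i * (\<Prod>q\<in>R. fps_nth (F q) (m q)))"
    using insert by (simp add: fps_mult_nth sum_distrib_left)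
  also have "\<dots> = (\<Sum>(i, m)\<in>Sigma {0..d} (\<lambda>i. ?S R (d - i)).
      fps_nth (F p) i * (\<Prod>q\<in>R. fps_nth (F q) (m q)))"
    by (rule sum.Sigma) (use fin in auto)
  also have "\<dots> = (\<Sum>m\<in>?S (insert p R) d. \<Prod>q\<in>insert p R. fps_nth (F q) (m q))"
  \<comment> \<open>An exponent function on \<open>insert p R\<close> corresponds to its value at
    \<open>p\<close> together with its restriction to \<open>R\<close>; resetting \<open>p\<close>
    to \<open>undefined\<close> makes the restriction extensional.\<close>
  proof (rule sum.reindex_bij_witness[where
        i = "\<lambda>m. (m p, m(p := undefined))" and j = "\<lambda>(i, m). m(p := i)"])
    fix a assume a: "a \<in> Sigma {0..d} (\<lambda>i. ?S R (d - i))"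
    obtain i m where im: "a = (i, m)" by force
    have m: "i \<le> d" "m \<in> R \<rightarrow>\<^sub>E UNIV" "sum m R = d - i" using a by (auto simp: im)
    then have "m p = undefined" using insert.hyps(2) by (auto simp: PiE_def extensional_def)
    then have "m(p := undefined) = m" by (metis fun_upd_triv)
    then show "((case a of (i, m) \<Rightarrow> m(p := i)) p, (case a of (i, m) \<Rightarrow> m(p := i))(p := undefined)) = a"
      by (simp add: im)
    show "(case a of (i, m) \<Rightarrow> m(p := i)) \<in> ?S (insert p R) d"
      using m insert.hyps by (auto simp: im upd PiE_def extensional_def simp del: fun_upd_apply) (auto split: if_splits)
    show "(\<Prod>q\<in>insert p R. fps_nth (F q) ((case a of (i, m) \<Rightarrow> m(p := i)) q)) =
        (case a of (i, m) \<Rightarrow> fps_nth (F p) i * (\<Prod>q\<in>R. fps_nth (F q) (m q)))"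
      using insert.hyps upd(2)[of m i] by (simp add: im del: fun_upd_apply) simp
  next
    fix m assume m: "m \<in> ?S (insert p R) d"
    show "(case (m p, m(p := undefined)) of (i, m) \<Rightarrow> m(p := i)) = m" by simp
    show "(m p, m(p := undefined)) \<in> Sigma {0..d} (\<lambda>i. ?S R (d - i))"
      using m insert.hyps by (auto simp: upd PiE_def extensional_def simp del: fun_upd_apply) auto
  qed
  finally show ?case .
qed

section \<open>The roots and the coefficients of \<open>B\<close>\<close>

lemma Roots_bounds:
  "(i, j) \<in> Roots \<eta> \<Longrightarrow> 1 \<le> i \<and> i < j \<and> j \<le> sum_list \<eta>"
  by (auto simp: Roots_def)

lemma finite_Roots: "finite (Roots \<eta>)"
  by (rule finite_subset[of _ "{1..sum_list \<eta>} \<times> {1..sum_list \<eta>}"])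
    (use Roots_bounds in fastforce)+

abbreviation root_weight :: "nat \<times> nat \<Rightarrow> weight"
  where "root_weight \<equiv> (\<lambda>(i, j). eps i - eps j)"

text \<open>The geometric series times the root factor telescopes to 1, and inverses in a
  commutative ring are unique.\<close>

lemma root_factor_inverse_eq:
  "fps_right_inverse (root_factor p) 1 = Abs_fps (\<lambda>k. xpow (frag_cmul (int k) (root_weight p)))"
    (is "?I = ?G")
proof -
  obtain i j where p: "p = (i, j)" by force
  have "fps_nth (root_factor p * ?G) d = fps_nth 1 d" for d
  proof (cases d)
    case (Suc e)
    have "root_factor p * ?G = ?G - fps_X * (fps_const (xpow (eps i - eps j)) * ?G)"
      by (simp add: root_factor_def p left_diff_distrib mult.assoc)
    moreover have "xpow (eps i - eps j) * xpow (frag_cmul (int e) (eps i - eps j)) =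
        xpow (frag_cmul (int (Suc e)) (eps i - eps j))"
      by (simp add: mult_single frag_cmul_distrib)
    ultimately show ?thesis by (simp add: Suc p)
  qed (simp add: root_factor_def p fps_mult_nth)
  then have "root_factor p * ?G = 1" by (rule fps_ext)
  then have "?I = ?I * (root_factor p * ?G)" by simp
  also have "\<dots> = (root_factor p * ?I) * ?G" by (simp only: mult_ac)
  finally show ?thesis by (simp only: root_factor_inverse mult_1_left)
qed

lemma prod_frag_of: "(\<Prod>i\<in>I. frag_of (f i)) = frag_of (\<Sum>i\<in>I. f i :: 'a::comm_monoid_add)"
  by (induction I rule: infinite_finite_induct) (simp_all add: mult_single)

lemma fps_nth_B:
  "fps_nth (B \<eta>) d = (\<Sum>m | m \<in> Roots \<eta> \<rightarrow>\<^sub>E (UNIV :: nat set) \<and> sum m (Roots \<eta>) = d.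
    xpow (\<Sum>p\<in>Roots \<eta>. frag_cmul (int (m p)) (root_weight p)))"
  unfolding B_def fps_nth_prod[OF finite_Roots] root_factor_inverse_eq
  by (simp add: prod_frag_of)

lemma keys_fps_nth_B: "keys (fps_nth (B \<eta>) d) \<subseteq> weights (sum_list \<eta>)"
proof -
  have "(\<Sum>p\<in>Roots \<eta>. frag_cmul (int (m p)) (root_weight p)) \<in> weights (sum_list \<eta>)" for m
    unfolding weights_iff lookup_sum
    by (intro allI impI sum.neutral) (use Roots_bounds in \<open>fastforce simp: lookup_minus\<close>)
  then show ?thesis
    unfolding fps_nth_B using keys_sum by (force simp: keys_frag_of)
qed

text \<open>Pairing the constraint with the weight \<open>(-1, \<dots>, -n)\<close>, on which every root is positive,
  bounds \<open>m\<close>.\<close>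

lemma finite_root_partitions:
  "finite {m \<in> Roots \<eta> \<rightarrow>\<^sub>E (UNIV :: nat set).
    (\<Sum>p\<in>Roots \<eta>. frag_cmul (int (m p)) (root_weight p)) = \<beta>}"
proof -
  let ?R = "Roots \<eta>" and ?n = "sum_list \<eta>"
  let ?L = "\<lambda>\<alpha>. \<Sum>k=1..?n. - int k * lookup \<alpha> k"
  have root: "1 \<le> ?L (root_weight p)" if "p \<in> ?R" for p
  proof -
    obtain i j where p: "p = (i, j)" by force
    have ij: "1 \<le> i" "i < j" "j \<le> ?n" using Roots_bounds that p by auto
    have "?L (root_weight p) = (\<Sum>k=1..?n. (if k = j then int k else 0) - (if k = i then int k else 0))"
      by (rule sum.cong) (auto simp: p lookup_minus)
    also have "\<dots> = int j - int i"
      using ij by (simp add: sum_subtractf sum.delta)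
    finally show ?thesis using ij by simp
  qed
  have "m p \<le> nat (?L \<beta>)"
    if m: "(\<Sum>p\<in>?R. frag_cmul (int (m p)) (root_weight p)) = \<beta>" and p: "p \<in> ?R" for m p
  proof -
    have "int (m p) \<le> (\<Sum>p\<in>?R. int (m p))"
      using p finite_Roots by (intro member_le_sum) auto
    also have "\<dots> \<le> (\<Sum>p\<in>?R. int (m p) * ?L (root_weight p))"
    proof (rule sum_mono)
      fix q assume "q \<in> ?R"
      from mult_left_mono[OF root[OF this], of "int (m q)"]
      show "int (m q) \<le> int (m q) * ?L (root_weight q)" by simp
    qed
    also have "\<dots> = ?L \<beta>"
      unfolding m[symmetric] lookup_sum sum_distrib_left
      by (subst sum.swap) (simp add: mult_ac)
    finally show ?thesis by simp
  qed
  then have "{m \<in> ?R \<rightarrow>\<^sub>E (UNIV :: nat set).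
      (\<Sum>p\<in>?R. frag_cmul (int (m p)) (root_weight p)) = \<beta>} \<subseteq> ?R \<rightarrow>\<^sub>E {..nat (?L \<beta>)}"
    by (auto simp: PiE_def)
  then show ?thesis
    by (rule finite_subset) (simp add: finite_PiE finite_Roots)
qed

text \<open>The left side fixes the degree and then selects the weight; the right side does the
  reverse. Both index sets are finite, the first because the degree bounds \<open>m\<close>, the
  second by \<open>finite_root_partitions\<close>.\<close>

lemma lookup_fps_nth_B:
  "lookup (fps_nth (B \<eta>) d) \<beta> =
    fps_nth (\<Sum>m\<in>{m \<in> Roots \<eta> \<rightarrow>\<^sub>E (UNIV :: nat set).
      (\<Sum>p\<in>Roots \<eta>. frag_cmul (int (m p)) (root_weight p)) = \<beta>}. fps_X ^ (\<Sum>p\<in>Roots \<eta>. m p)) d"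
proof -
  let ?R = "Roots \<eta>" and ?P = "\<lambda>m. \<Sum>p\<in>Roots \<eta>. frag_cmul (int (m p)) (root_weight p)"
  let ?M = "?R \<rightarrow>\<^sub>E (UNIV :: nat set)"
  have fin: "finite {m. m \<in> ?M \<and> sum m ?R = d}"
  proof (rule finite_subset)
    show "{m. m \<in> ?M \<and> sum m ?R = d} \<subseteq> ?R \<rightarrow>\<^sub>E {..d}"
      by (auto simp: PiE_def finite_Roots intro: member_le_sum)
  qed (auto simp: finite_Roots intro: finite_PiE)
  have "lookup (fps_nth (B \<eta>) d) \<beta> =
      (\<Sum>m | m \<in> ?M \<and> sum m ?R = d. if ?P m = \<beta> then 1 else 0)"
    by (auto simp: fps_nth_B lookup_sum intro!: sum.cong)
  also have "\<dots> = (\<Sum>m | m \<in> ?M \<and> sum m ?R = d \<and> ?P m = \<beta>. 1)"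
    using fin by (intro sum.mono_neutral_cong_right) auto
  also have "\<dots> = (\<Sum>m\<in>{m \<in> ?M. ?P m = \<beta>}. if sum m ?R = d then 1 else 0)"
    using finite_root_partitions[of \<eta> \<beta>] by (intro sum.mono_neutral_cong_left) auto
  also have "\<dots> = fps_nth (\<Sum>m\<in>{m \<in> ?M. ?P m = \<beta>}. fps_X ^ (\<Sum>p\<in>?R. m p)) d"
    unfolding fps_sum_nth by (intro sum.cong refl) (auto simp: fps_X_power_nth)
  finally show ?thesis .
qed

text \<open>This resolves the definite description in \<open>Kpoly\<close>: being a Schur expansion
  amounts to prescribing every coefficient at dominant weights, and the value 0 elsewhere leaves
  exactly one family.\<close>

lemma Kpoly_nth:
  assumes "\<gamma> \<in> weights (sum_list \<eta>)" "\<mu> \<in> dominant_weights (sum_list \<eta>)"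
  shows "fps_nth (Kpoly \<mu> \<gamma> \<eta>) d =
    lookup (J (sum_list \<eta>) (xpow (rho (sum_list \<eta>)) * (xpow \<gamma> * fps_nth (B \<eta>) d)))
      (\<mu> + rho (sum_list \<eta>))"
proof -
  let ?n = "sum_list \<eta>"
  define a where "a \<nu> d = lookup (J ?n (xpow (rho ?n) * (xpow \<gamma> * fps_nth (B \<eta>) d))) (\<nu> + rho ?n)" for \<nu> d
  define K where "K \<nu> = (if \<nu> \<in> dominant_weights ?n then Abs_fps (a \<nu>) else 0)" for \<nu>
  have "keys (xpow \<gamma> * fps_nth (B \<eta>) d) \<subseteq> weights ?n" for d
    by (intro keys_xpow_mult assms keys_fps_nth_B)
  note coeff = Pi_op_eq_schur_sum_iff[OF this, folded a_def]
  have iff: "schur_expansion ?n (H \<eta> \<gamma>) K' \<longleftrightarrow>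
      (\<forall>d. \<forall>\<nu>\<in>dominant_weights ?n. fps_nth (K' \<nu>) d = a \<nu> d)" for K'
    by (simp only: schur_expansion_def H_def fps_nth_Abs_fps fps_mult_left_const_nth coeff)
  have "(THE K. schur_expansion ?n (H \<eta> \<gamma>) K \<and> (\<forall>\<nu>. \<nu> \<notin> dominant_weights ?n \<longrightarrow> K \<nu> = 0)) = K"
  proof (rule the_equality)
    fix K' assume "schur_expansion ?n (H \<eta> \<gamma>) K' \<and> (\<forall>\<nu>. \<nu> \<notin> dominant_weights ?n \<longrightarrow> K' \<nu> = 0)"
    then show "K' = K"
      by (intro ext fps_ext) (auto simp: iff K_def)
  qed (simp add: iff K_def)
  then show ?thesis using assms(2) by (simp add: Kpoly_def K_def a_def)
qed

theorem proposition6: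
  fixes \<eta> :: "nat list" and n :: nat and \<gamma> \<mu> :: weight
  assumes "\<forall>k\<in>set \<eta>. 0 < k"
    and "n = sum_list \<eta>"
    and "\<gamma> \<in> weights n"
    and "\<mu> \<in> dominant_weights n"
  shows "Kpoly \<mu> \<gamma> \<eta> =
    (\<Sum>w | w permutes {1..n}. of_int (sign w) *
       (\<Sum>m \<in> {m \<in> Roots \<eta> \<rightarrow>\<^sub>E (UNIV :: nat set).
                (\<Sum>(i, j)\<in>Roots \<eta>. frag_cmul (int (m (i, j))) (eps i - eps j)) =
                perm_weight (inv w) (\<mu> + rho n) - (\<gamma> + rho n)}.
          fps_X ^ (\<Sum>p\<in>Roots \<eta>. m p)))"
proof (rule fps_ext)
  fix d
  have curry: "(\<Sum>(i, j)\<in>Roots \<eta>. frag_cmul (int (m (i, j))) (eps i - eps j)) =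
      (\<Sum>p\<in>Roots \<eta>. frag_cmul (int (m p)) (root_weight p))" for m
    by (intro sum.cong) auto
  \<comment> \<open>Multiplication by the monomial of exponent \<open>\<gamma> + rho n\<close>
    translates coefficients; with \<alpha> the permuted \<open>\<mu> + rho n\<close>, this is the
    right-hand side of the constraint on \<open>m\<close>.\<close>
  have "lookup (xpow (rho n) * (xpow \<gamma> * fps_nth (B \<eta>) d)) \<alpha> =
      lookup (fps_nth (B \<eta>) d) (\<alpha> - (\<gamma> + rho n))" for \<alpha>
    by (simp add: lookup_frag_of_mult diff_diff_add add.commute)
  moreover have "fps_nth (of_int c * F) d = c * fps_nth F d" for c :: int and F :: "int fps"
    by (simp flip: fps_of_int)
  ultimately show "fps_nth (Kpoly \<mu> \<gamma> \<eta>) d = fps_nth (\<Sum>w | w permutes {1..n}. of_int (sign w) *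
       (\<Sum>m \<in> {m \<in> Roots \<eta> \<rightarrow>\<^sub>E (UNIV :: nat set).
                (\<Sum>(i, j)\<in>Roots \<eta>. frag_cmul (int (m (i, j))) (eps i - eps j)) =
                perm_weight (inv w) (\<mu> + rho n) - (\<gamma> + rho n)}.
          fps_X ^ (\<Sum>p\<in>Roots \<eta>. m p))) d"
    using Kpoly_nth[of \<gamma> \<eta> \<mu> d] assms(2-4)
    by (simp add: fps_sum_nth lookup_J lookup_fps_nth_B curry)
qed

end
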